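(* Let $\Lambda$ be an action operad. Then $E\Lambda=\{E\Lambda(n)\}_{n\in\mathbb N}$ is a $\Lambda$-operad in $\mathbf{Cat}$ (with operad structure and right $\Lambda(n)$-actions given on objects by the operad structure of $\Lambda$ and by right multiplication in $\Lambda(n)$).
   Context: $\mathbb N\ni 0$; $e_n$ is the identity of $\Lambda(n)$; permutations compose as functions. A (non-symmetric) operad $O$ in sets: sets $O(n)$ ($n\in\mathbb N$), $\mathrm{id}\in O(1)$, functions $\mu:O(n)\times O(k_1)\times\cdots\times O(k_n)\to O(k_1+\cdots+k_n)$, unital and associative in the usual sense; maps preserve $\mathrm{id}$ and $\mu$. The operad $\Sigma$ of symmetric groups has $\mu(\sigma;\tau_1,\dots,\tau_n)=\delta(\sigma)\cdot\beta(\tau_1,\dots,\tau_n)$, with $\beta$ the block sum of the permutations $\tau_i\in\Sigma_{k_i}$ and $\delta(\sigma)=\delta_{n;k_1,\dots,k_n}(\sigma)$ sending $k_1+\cdots+k_{i-1}+a$ ($1\le a\le k_i$) to $(\sum_{\sigma(i')<\sigma(i)}k_{i'})+a$. An action operad $(\Lambda,\pi)$: an operad $\Lambda$ in sets with a group structure on each $\Lambda(n)$ and a map of operads $\pi:\Lambda\to\Sigma$ whose components are group homomorphisms, such that, writing $g(i)=\pi_n(g)(i)$ and $g^{-1}(i)=\pi_n(g)^{-1}(i)$, $\mu(g';f_1',\dots,f_n')\mu(g;f_1,\dots,f_n)=\mu(g'g;f'_{g(1)}f_1,\dots,f'_{g(n)}f_n)$ for $g,g'\in\Lambda(n)$, $f_i\in\Lambda(k_i)$,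 $f_i'\in\Lambda(k_{g^{-1}(i)})$. Put $\beta^\Lambda(g_1,\dots,g_n)=\mu(e_n;g_1,\dots,g_n)$ and $\delta^\Lambda_{n;k_1,\dots,k_n}(g)=\mu(g;e_{k_1},\dots,e_{k_n})$. A $\Lambda$-operad $P$ in $\mathbf{Cat}$: small categories $P(n)$, an object $\mathrm{id}\in P(1)$, functors $\mu:P(n)\times P(k_1)\times\cdots\times P(k_n)\to P(k_1+\cdots+k_n)$, strictly unital and associative, with strict right actions of $\Lambda(n)$ on $P(n)$ by functors such that (for objects and for morphisms) $\mu(p;q_1\cdot g_1,\dots,q_n\cdot g_n)=\mu(p;q_1,\dots,q_n)\cdot\beta^\Lambda(g_1,\dots,g_n)$ and $\mu(p\cdot g;q_1,\dots,q_n)=\mu(p;q_{g^{-1}(1)},\dots,q_{g^{-1}(n)})\cdot\delta^\Lambda_{n;k_1,\dots,k_n}(g)$. For a set $X$, $EX$ is the category with object set $X$ and exactly one morphism (an isomorphism) between any two objects. *)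

theory Defs
  imports "HOL-Algebra.Sym_Groups"
begin

text \<open>
  A tuple \<open>(x\<^sub>1, \<dots>, x\<^sub>n)\<close> is a list. Its positions are numbered from 1, in agreement with
  \<^term>\<open>sym_group n\<close>, whose elements are the permutations of \<^term>\<open>{1..n}\<close>.
\<close>

abbreviation nth1 :: "'a list \<Rightarrow> nat \<Rightarrow> 'a"  (infixl "!\<^sub>1" 100)
  where "xs !\<^sub>1 i \<equiv> xs ! (i - 1)"

definition tuple :: "nat \<Rightarrow> (nat \<Rightarrow> 'a) \<Rightarrow> 'a list"
  where "tuple n f = map f [1..<Suc n]"

definition reindex :: "(nat \<Rightarrow> nat) \<Rightarrow> 'a list \<Rightarrow> 'a list"
  where "reindex s xs = tuple (length xs) (\<lambda>i. xs !\<^sub>1 s i)"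


section \<open>Operads in sets\<close>

text \<open>
  The sets \<open>O(n)\<close> need not be disjoint, so the composition
  \<open>O(n) \<times> O(k\<^sub>1) \<times> \<dots> \<times> O(k\<^sub>n) \<rightarrow> O(k\<^sub>1 + \<dots> + k\<^sub>n)\<close> is a family of functions, indexed by the
  list \<open>[k\<^sub>1, \<dots>, k\<^sub>n]\<close>, whose length is \<open>n\<close>. For the same reason maps and actions below
  carry the arity as an argument.
\<close>

record 'a operad =
  ops :: "nat \<Rightarrow> 'a set"
  opid :: 'a
  opmu :: "nat list \<Rightarrow> 'a \<Rightarrow> 'a list \<Rightarrow> 'a"

abbreviation args :: "('a, 'b) operad_scheme \<Rightarrow> nat list \<Rightarrow> 'a list set"
  where "args A ks \<equiv> listset (map (ops A) ks)"

definition operad :: "('a, 'b) operad_scheme \<Rightarrow> bool" where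
  "operad A \<longleftrightarrow>
     opid A \<in> ops A 1 \<and>
     (\<forall>ks. \<forall>p \<in> ops A (length ks). \<forall>qs \<in> args A ks. opmu A ks p qs \<in> ops A (sum_list ks)) \<and>
     (\<forall>k. \<forall>q \<in> ops A k. opmu A [k] (opid A) [q] = q) \<and>
     (\<forall>n. \<forall>p \<in> ops A n. opmu A (replicate n 1) p (replicate n (opid A)) = p) \<and>
     (\<forall>jss. \<forall>p \<in> ops A (length jss). \<forall>qs \<in> args A (map length jss).
        \<forall>rss \<in> listset (map (args A) jss).
          opmu A (concat jss) (opmu A (map length jss) p qs) (concat rss) =
          opmu A (map sum_list jss) p
            (tuple (length jss) (\<lambda>i. opmu A (jss !\<^sub>1 i) (qs !\<^sub>1 i) (rss !\<^sub>1 i))))"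

definition operad_map ::
  "('a, 'c) operad_scheme \<Rightarrow> ('b, 'd) operad_scheme \<Rightarrow> (nat \<Rightarrow> 'a \<Rightarrow> 'b) \<Rightarrow> bool" where
  "operad_map A B f \<longleftrightarrow>
     (\<forall>n. \<forall>p \<in> ops A n. f n p \<in> ops B n) \<and>
     f 1 (opid A) = opid B \<and>
     (\<forall>ks. \<forall>p \<in> ops A (length ks). \<forall>qs \<in> args A ks.
        f (sum_list ks) (opmu A ks p qs) =
        opmu B ks (f (length ks) p) (tuple (length ks) (\<lambda>i. f (ks !\<^sub>1 i) (qs !\<^sub>1 i))))"


section \<open>The operad of symmetric groups\<close>

text \<open>
  For \<open>m\<close> in \<open>{1..k\<^sub>1 + \<dots> + k\<^sub>n}\<close>, the numbers \<open>i = block ks m\<close> and \<open>a = place ks m\<close> are the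
  unique ones with \<open>m = k\<^sub>1 + \<dots> + k\<^bsub>i-1\<^esub> + a\<close> and \<open>1 \<le> a \<le> k\<^sub>i\<close>.
\<close>

definition offset :: "nat list \<Rightarrow> nat \<Rightarrow> nat"
  where "offset ks i = sum_list (take (i - 1) ks)"

definition block :: "nat list \<Rightarrow> nat \<Rightarrow> nat"
  where "block ks m = (LEAST i. m \<le> sum_list (take i ks))"

definition place :: "nat list \<Rightarrow> nat \<Rightarrow> nat"
  where "place ks m = m - offset ks (block ks m)"

definition Sigma_beta :: "nat list \<Rightarrow> (nat \<Rightarrow> nat) list \<Rightarrow> nat \<Rightarrow> nat" where
  "Sigma_beta ks ts m =
     (if m \<in> {1..sum_list ks}
      then offset ks (block ks m) + (ts !\<^sub>1 block ks m) (place ks m) else m)"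

definition Sigma_delta :: "nat list \<Rightarrow> (nat \<Rightarrow> nat) \<Rightarrow> nat \<Rightarrow> nat" where
  "Sigma_delta ks s m =
     (if m \<in> {1..sum_list ks}
      then (\<Sum>i' \<in> {i' \<in> {1..length ks}. s i' < s (block ks m)}. ks !\<^sub>1 i') + place ks m else m)"

definition Sigma_operad :: "(nat \<Rightarrow> nat) operad" where
  "Sigma_operad =
     \<lparr> ops = \<lambda>n. carrier (sym_group n),
       opid = id,
       opmu = \<lambda>ks s ts. Sigma_delta ks s \<circ> Sigma_beta ks ts \<rparr>"

lemma block_place:
  assumes "i \<in> {1..length ks}" "a \<in> {1..ks !\<^sub>1 i}"
  shows "block ks (offset ks i + a) = i" "place ks (offset ks i + a) = a"
    "offset ks i + a \<in> {1..sum_list ks}"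
proof -
  have up: "offset ks i + a \<le> sum_list (take i ks)"
    using assms take_Suc_conv_app_nth[of "i - 1" ks] by (auto simp: offset_def)
  have mono: "sum_list (take j ks) \<le> sum_list (take l ks)" if "j \<le> l" for j l
  proof -
    have "take l ks = take j ks @ take (l - j) (drop j ks)"
      using that by (metis le_add_diff_inverse take_add)
    then show ?thesis by simp
  qed
  show b: "block ks (offset ks i + a) = i"
    unfolding block_def
  proof (rule Least_equality)
    show "offset ks i + a \<le> sum_list (take i ks)" by (rule up)
  next
    fix j assume "offset ks i + a \<le> sum_list (take j ks)"
    moreover have "sum_list (take j ks) \<le> offset ks i" if "j < i"
      using that mono[of j "i - 1"] by (simp add: offset_def)
    ultimately show "i \<le> j"
      using assms(2) by (cases "i \<le> j") auto
  qed
  show "place ks (offset ks i + a) = a"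
    by (simp add: place_def b)
  show "offset ks i + a \<in> {1..sum_list ks}"
    using up mono[of i "length ks"] assms by auto
qed

lemma Sigma_beta_block:
  assumes "i \<in> {1..length ks}" "a \<in> {1..ks !\<^sub>1 i}"
  shows "Sigma_beta ks ts (offset ks i + a) = offset ks i + (ts !\<^sub>1 i) a"
  using block_place[OF assms] by (simp add: Sigma_beta_def)

lemma Sigma_delta_block:
  assumes "i \<in> {1..length ks}" "a \<in> {1..ks !\<^sub>1 i}"
  shows "Sigma_delta ks s (offset ks i + a) =
    (\<Sum>i' \<in> {i' \<in> {1..length ks}. s i' < s i}. ks !\<^sub>1 i') + a"
  using block_place[OF assms] by (simp add: Sigma_delta_def)


section \<open>Action operads\<close>

record 'g action_operad = "'g operad" +
  grp :: "nat \<Rightarrow> 'g monoid"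
  perm :: "nat \<Rightarrow> 'g \<Rightarrow> nat \<Rightarrow> nat"

abbreviation perm_inv :: "'g action_operad \<Rightarrow> nat \<Rightarrow> 'g \<Rightarrow> nat \<Rightarrow> nat"
  where "perm_inv L n g \<equiv> inv' (perm L n g)"

definition action_operad :: "'g action_operad \<Rightarrow> bool" where
  "action_operad L \<longleftrightarrow>
     operad L \<and>
     (\<forall>n. group (grp L n) \<and> carrier (grp L n) = ops L n) \<and>
     operad_map L Sigma_operad (perm L) \<and>
     (\<forall>n. perm L n \<in> hom (grp L n) (sym_group n)) \<and>
     (\<forall>ks. \<forall>g \<in> ops L (length ks). \<forall>g' \<in> ops L (length ks). \<forall>fs \<in> args L ks.
        \<forall>fs' \<in> args L (reindex (perm_inv L (length ks) g) ks).
          opmu L (reindex (perm_inv L (length ks) g) ks) g' fs'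
            \<otimes>\<^bsub>grp L (sum_list ks)\<^esub> opmu L ks g fs =
          opmu L ks (g' \<otimes>\<^bsub>grp L (length ks)\<^esub> g)
            (tuple (length ks) (\<lambda>i.
               (fs' !\<^sub>1 perm L (length ks) g i) \<otimes>\<^bsub>grp L (ks !\<^sub>1 i)\<^esub> (fs !\<^sub>1 i))))"

definition Lambda_beta :: "'g action_operad \<Rightarrow> nat list \<Rightarrow> 'g list \<Rightarrow> 'g"
  where "Lambda_beta L ks gs = opmu L ks \<one>\<^bsub>grp L (length ks)\<^esub> gs"

definition Lambda_delta :: "'g action_operad \<Rightarrow> nat list \<Rightarrow> 'g \<Rightarrow> 'g"
  where "Lambda_delta L ks g = opmu L ks g (map (\<lambda>k. \<one>\<^bsub>grp L k\<^esub>) ks)"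

definition right_action :: "'g monoid \<Rightarrow> 'a set \<Rightarrow> ('a \<Rightarrow> 'g \<Rightarrow> 'a) \<Rightarrow> bool" where
  "right_action G X act \<longleftrightarrow>
     (\<forall>x \<in> X. \<forall>g \<in> carrier G. act x g \<in> X) \<and>
     (\<forall>x \<in> X. act x \<one>\<^bsub>G\<^esub> = x) \<and>
     (\<forall>x \<in> X. \<forall>g \<in> carrier G. \<forall>h \<in> carrier G. act x (g \<otimes>\<^bsub>G\<^esub> h) = act (act x g) h)"

definition equivariant_operad ::
  "'g action_operad \<Rightarrow> 'a operad \<Rightarrow> (nat \<Rightarrow> 'a \<Rightarrow> 'g \<Rightarrow> 'a) \<Rightarrow> bool" where
  "equivariant_operad L A act \<longleftrightarrow>
     operad A \<and>
     (\<forall>n. right_action (grp L n) (ops A n) (act n)) \<and>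
     (\<forall>ks. \<forall>p \<in> ops A (length ks). \<forall>qs \<in> args A ks. \<forall>gs \<in> args L ks.
        opmu A ks p (tuple (length ks) (\<lambda>i. act (ks !\<^sub>1 i) (qs !\<^sub>1 i) (gs !\<^sub>1 i))) =
        act (sum_list ks) (opmu A ks p qs) (Lambda_beta L ks gs)) \<and>
     (\<forall>ks. \<forall>p \<in> ops A (length ks). \<forall>qs \<in> args A ks. \<forall>g \<in> ops L (length ks).
        opmu A ks (act (length ks) p g) qs =
        act (sum_list ks)
          (opmu A (reindex (perm_inv L (length ks) g) ks) p
            (reindex (perm_inv L (length ks) g) qs))
          (Lambda_delta L ks g))"


section \<open>Small categories\<close>

text \<open>\<open>Comp C g f\<close> is \<open>g\<close> after \<open>f\<close>, meaningful when \<open>Dom C g = Cod C f\<close>.\<close>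

record ('o, 'm) cat =
  Obj :: "'o set"
  Arr :: "'m set"
  Dom :: "'m \<Rightarrow> 'o"
  Cod :: "'m \<Rightarrow> 'o"
  Ident :: "'o \<Rightarrow> 'm"
  Comp :: "'m \<Rightarrow> 'm \<Rightarrow> 'm"

definition category :: "('o, 'm) cat \<Rightarrow> bool" where
  "category C \<longleftrightarrow>
     (\<forall>f \<in> Arr C. Dom C f \<in> Obj C \<and> Cod C f \<in> Obj C) \<and>
     (\<forall>x \<in> Obj C. Ident C x \<in> Arr C \<and> Dom C (Ident C x) = x \<and> Cod C (Ident C x) = x) \<and>
     (\<forall>f \<in> Arr C. \<forall>g \<in> Arr C. Dom C g = Cod C f \<longrightarrow>
        Comp C g f \<in> Arr C \<and> Dom C (Comp C g f) = Dom C f \<and> Cod C (Comp C g f) = Cod C g) \<and>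
     (\<forall>f \<in> Arr C. Comp C f (Ident C (Dom C f)) = f \<and> Comp C (Ident C (Cod C f)) f = f) \<and>
     (\<forall>f \<in> Arr C. \<forall>g \<in> Arr C. \<forall>h \<in> Arr C. Dom C g = Cod C f \<longrightarrow> Dom C h = Cod C g \<longrightarrow>
        Comp C h (Comp C g f) = Comp C (Comp C h g) f)"

definition is_functor ::
  "('o, 'm) cat \<Rightarrow> ('p, 'n) cat \<Rightarrow> ('o \<Rightarrow> 'p) \<Rightarrow> ('m \<Rightarrow> 'n) \<Rightarrow> bool" where
  "is_functor C D F\<^sub>o F\<^sub>m \<longleftrightarrow>
     category C \<and> category D \<and>
     (\<forall>x \<in> Obj C. F\<^sub>o x \<in> Obj D \<and> F\<^sub>m (Ident C x) = Ident D (F\<^sub>o x)) \<and>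
     (\<forall>f \<in> Arr C. F\<^sub>m f \<in> Arr D \<and> Dom D (F\<^sub>m f) = F\<^sub>o (Dom C f) \<and> Cod D (F\<^sub>m f) = F\<^sub>o (Cod C f)) \<and>
     (\<forall>f \<in> Arr C. \<forall>g \<in> Arr C. Dom C g = Cod C f \<longrightarrow>
        F\<^sub>m (Comp C g f) = Comp D (F\<^sub>m g) (F\<^sub>m f))"

definition prod_cat :: "('o, 'm) cat list \<Rightarrow> ('o list, 'm list) cat" where
  "prod_cat Cs =
     \<lparr> Obj = listset (map Obj Cs),
       Arr = listset (map Arr Cs),
       Dom = map2 Dom Cs,
       Cod = map2 Cod Cs,
       Ident = map2 Ident Cs,
       Comp = \<lambda>gs fs. tuple (length Cs) (\<lambda>i. Comp (Cs !\<^sub>1 i) (gs !\<^sub>1 i) (fs !\<^sub>1 i)) \<rparr>"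

text \<open>The only morphism from \<open>x\<close> to \<open>y\<close> in \<open>EX\<close> is the pair \<open>(x, y)\<close>.\<close>

definition E_cat :: "'a set \<Rightarrow> ('a, 'a \<times> 'a) cat" where
  "E_cat X =
     \<lparr> Obj = X, Arr = X \<times> X, Dom = fst, Cod = snd,
       Ident = \<lambda>x. (x, x), Comp = \<lambda>g f. (fst f, snd g) \<rparr>"


section \<open>Operads in Cat over an action operad\<close>

record ('o, 'm, 'g) cat_operad =
  cats :: "nat \<Rightarrow> ('o, 'm) cat"
  cid :: 'o
  mu_obj :: "nat list \<Rightarrow> 'o \<Rightarrow> 'o list \<Rightarrow> 'o"
  mu_arr :: "nat list \<Rightarrow> 'm \<Rightarrow> 'm list \<Rightarrow> 'm"
  act_obj :: "nat \<Rightarrow> 'o \<Rightarrow> 'g \<Rightarrow> 'o"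
  act_arr :: "nat \<Rightarrow> 'm \<Rightarrow> 'g \<Rightarrow> 'm"

definition obj_operad :: "('o, 'm, 'g) cat_operad \<Rightarrow> 'o operad" where
  "obj_operad P = \<lparr> ops = \<lambda>n. Obj (cats P n), opid = cid P, opmu = mu_obj P \<rparr>"

text \<open>On morphisms the unit is the identity morphism of the object \<open>id\<close>.\<close>

definition arr_operad :: "('o, 'm, 'g) cat_operad \<Rightarrow> 'm operad" where
  "arr_operad P =
     \<lparr> ops = \<lambda>n. Arr (cats P n), opid = Ident (cats P 1) (cid P), opmu = mu_arr P \<rparr>"

text \<open>
  Equations between functors are equations on objects and on morphisms, so the axioms are
  imposed on the operad of objects and on the operad of morphisms. The source
  \<open>P(n) \<times> P(k\<^sub>1) \<times> \<dots> \<times> P(k\<^sub>n)\<close> of the composition functor is a product of \<open>n + 1\<close> categories,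
  hence the head and tail.
\<close>

definition Lambda_operad :: "'g action_operad \<Rightarrow> ('o, 'm, 'g) cat_operad \<Rightarrow> bool" where
  "Lambda_operad L P \<longleftrightarrow>
     (\<forall>n. category (cats P n)) \<and>
     (\<forall>ks. is_functor (prod_cat (cats P (length ks) # map (cats P) ks)) (cats P (sum_list ks))
        (\<lambda>xs. mu_obj P ks (hd xs) (tl xs)) (\<lambda>fs. mu_arr P ks (hd fs) (tl fs))) \<and>
     (\<forall>n. \<forall>g \<in> ops L n. is_functor (cats P n) (cats P n)
        (\<lambda>x. act_obj P n x g) (\<lambda>f. act_arr P n f g)) \<and>
     equivariant_operad L (obj_operad P) (act_obj P) \<and>
     equivariant_operad L (arr_operad P) (act_arr P)"

text \<open>
  Since \<open>E\<Lambda>(n)\<close> has exactly one morphism between two objects, the structure maps on objects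
  determine those on morphisms: they act on sources and on targets.
\<close>

definition E_operad :: "'g action_operad \<Rightarrow> ('g, 'g \<times> 'g, 'g) cat_operad" where
  "E_operad L =
     \<lparr> cats = \<lambda>n. E_cat (ops L n),
       cid = opid L,
       mu_obj = opmu L,
       mu_arr = \<lambda>ks f fs. (opmu L ks (fst f) (map fst fs), opmu L ks (snd f) (map snd fs)),
       act_obj = \<lambda>n x g. x \<otimes>\<^bsub>grp L n\<^esub> g,
       act_arr = \<lambda>n f g. (fst f \<otimes>\<^bsub>grp L n\<^esub> g, snd f \<otimes>\<^bsub>grp L n\<^esub> g) \<rparr>"

end

theory Submission
  imports Defs
begin

text \<open>
  On objects, both equivariance axioms are instances of the interchange law of \<open>\<Lambda>\<close>: take
  \<open>g = e\<^sub>n\<close> for the first and \<open>f\<^sub>i = e\<close> for the second. On morphisms everything is the square of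
  the situation on objects, since a morphism of \<open>EX\<close> is a pair of objects, and functoriality of a
  map into \<open>EX\<close> is automatic.
\<close>

section \<open>Tuples, reindexing and products of sets\<close>

lemma in_listset_iff:
  "xs \<in> listset As \<longleftrightarrow> length xs = length As \<and> (\<forall>i < length As. xs ! i \<in> As ! i)"
proof (induction As arbitrary: xs)
  case (Cons A As)
  then show ?case
    by (cases xs) (auto simp: set_Cons_def All_less_Suc2)
qed simp

lemma in_listset_map_iff:
  "xs \<in> listset (map f ys) \<longleftrightarrow> length xs = length ys \<and> (\<forall>i < length ys. xs ! i \<in> f (ys ! i))"
  by (auto simp: in_listset_iff)

lemma length_tuple [simp]: "length (tuple n f) = n"
  by (simp add: tuple_def)

lemma nth_tuple [simp]: "i < n \<Longrightarrow> tuple n f ! i = f (Suc i)"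
  by (simp add: tuple_def del: upt_Suc)

lemma map_tuple: "map h (tuple n f) = tuple n (\<lambda>i. h (f i))"
  by (simp add: tuple_def)

lemma tuple_cong: "(\<And>i. i \<in> {1..n} \<Longrightarrow> f i = g i) \<Longrightarrow> tuple n f = tuple n g"
  by (auto simp: tuple_def)

lemma length_reindex [simp]: "length (reindex s xs) = length xs"
  by (simp add: reindex_def)

lemma reindex_id [simp]: "reindex id xs = xs"
  by (rule nth_equalityI) (simp_all add: reindex_def)

text \<open>\<open>s\<close> must keep the positions \<open>1..length xs\<close> in range:
  \<open>nth\<close> commutes with \<open>map\<close> only at valid positions.\<close>

lemma map_reindex:
  assumes "s permutes {1..length xs}"
  shows "map f (reindex s xs) = reindex s (map f xs)"
proof (rule nth_equalityI)
  fix i assume "i < length (map f (reindex s xs))"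
  then have "s (Suc i) \<in> {1..length xs}"
    using permutes_in_image[OF assms, of "Suc i"] by auto
  then show "map f (reindex s xs) ! i = reindex s (map f xs) ! i"
    using \<open>i < _\<close> by (auto simp: reindex_def)
qed simp

text \<open>Supplies the typing of the primed arguments in the interchange law, which live over the
  permuted list of arities.\<close>

lemma reindex_in_listset:
  assumes "xs \<in> listset (map X ks)" "s permutes {1..length ks}"
  shows "reindex s xs \<in> listset (map X (reindex s ks))"
proof -
  have "s (Suc i) \<in> {1..length ks}" if "i < length ks" for i
    using permutes_in_image[OF assms(2), of "Suc i"] that by auto
  then show ?thesis
    using assms(1) by (force simp: in_listset_map_iff reindex_def)
qed

lemma map_fst_in_listset:
  "ps \<in> listset (map (\<lambda>k. X k \<times> Y k) ks) \<Longrightarrow> map fst ps \<in> listset (map X ks)"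
  by (auto simp: in_listset_map_iff mem_Times_iff)

lemma map_snd_in_listset:
  "ps \<in> listset (map (\<lambda>k. X k \<times> Y k) ks) \<Longrightarrow> map snd ps \<in> listset (map Y ks)"
  by (auto simp: in_listset_map_iff mem_Times_iff)


section \<open>The square of an operad\<close>

text \<open>Morphisms of \<open>E_cat X\<close> are pairs of objects, so this is what the operad of
  morphisms of \<open>E_operad\<close> turns out to be. Isolating it allows the axioms to be checked
  one coordinate at a time.\<close>

definition square_operad :: "('a, 'b) operad_scheme \<Rightarrow> ('a \<times> 'a) operad" where
  "square_operad A =
     \<lparr> ops = \<lambda>n. ops A n \<times> ops A n, opid = (opid A, opid A),
       opmu = \<lambda>ks f fs. (opmu A ks (fst f) (map fst fs), opmu A ks (snd f) (map snd fs)) \<rparr>"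

lemma square_operad_simps [simp]:
  "ops (square_operad A) n = ops A n \<times> ops A n"
  "opid (square_operad A) = (opid A, opid A)"
  "opmu (square_operad A) ks f fs =
     (opmu A ks (fst f) (map fst fs), opmu A ks (snd f) (map snd fs))"
  by (simp_all add: square_operad_def)

text \<open>Inside \<open>args\<close> the function \<open>ops (square_operad A)\<close> occurs
  without its argument, where the simp rule above cannot fire. The right-hand side has the shape
  expected by \<open>map_fst_in_listset\<close> and \<open>map_snd_in_listset\<close>.\<close>

lemma map_ops_square_operad:
  "map (ops (square_operad A)) ks = map (\<lambda>k. ops A k \<times> ops A k) ks"
  by simp

lemma args_squareD:
  assumes "qs \<in> args (square_operad A) ks"
  shows "map fst qs \<in> args A ks" "map snd qs \<in> args A ks" "length qs = length ks"
  using assms map_fst_in_listset map_snd_in_listset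
  unfolding map_ops_square_operad by (blast, blast, simp add: in_listset_iff)

lemma operadD:
  assumes "operad A"
  shows operad_id: "opid A \<in> ops A 1"
    and operad_closed: "\<And>ks p qs. p \<in> ops A (length ks) \<Longrightarrow> qs \<in> args A ks \<Longrightarrow>
      opmu A ks p qs \<in> ops A (sum_list ks)"
    and operad_unit_left: "\<And>k q. q \<in> ops A k \<Longrightarrow> opmu A [k] (opid A) [q] = q"
    and operad_unit_right: "\<And>n p. p \<in> ops A n \<Longrightarrow>
      opmu A (replicate n 1) p (replicate n (opid A)) = p"
    and operad_assoc: "\<And>jss p qs rss. p \<in> ops A (length jss) \<Longrightarrow>
      qs \<in> args A (map length jss) \<Longrightarrow> rss \<in> listset (map (args A) jss) \<Longrightarrow>
      opmu A (concat jss) (opmu A (map length jss) p qs) (concat rss) =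
      opmu A (map sum_list jss) p
        (tuple (length jss) (\<lambda>i. opmu A (jss !\<^sub>1 i) (qs !\<^sub>1 i) (rss !\<^sub>1 i)))"
  using assms unfolding operad_def by blast+

lemma operad_square:
  assumes A: "operad A"
  shows "operad (square_operad A)"
  unfolding operad_def
proof (intro conjI allI ballI)
  show "opid (square_operad A) \<in> ops (square_operad A) 1"
    using operad_id[OF A] by simp
next
  fix ks p qs
  assume "p \<in> ops (square_operad A) (length ks)" "qs \<in> args (square_operad A) ks"
  then show "opmu (square_operad A) ks p qs \<in> ops (square_operad A) (sum_list ks)"
    using operad_closed[OF A] args_squareD[of qs A ks] by auto
next
  fix k q
  assume "q \<in> ops (square_operad A) k"
  then show "opmu (square_operad A) [k] (opid (square_operad A)) [q] = q"
    using operad_unit_left[OF A] by auto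
next
  fix n p
  assume "p \<in> ops (square_operad A) n"
  then show "opmu (square_operad A) (replicate n 1) p (replicate n (opid (square_operad A))) = p"
    using operad_unit_right[OF A] by auto
next
  fix jss p qs rss
  assume p: "p \<in> ops (square_operad A) (length jss)"
    and qs: "qs \<in> args (square_operad A) (map length jss)"
    and rss: "rss \<in> listset (map (args (square_operad A)) jss)"
  have len: "length qs = length jss" "length rss = length jss"
    using qs rss by (simp_all add: in_listset_iff)
  have "map (map fst) rss \<in> listset (map (args A) jss)"
       "map (map snd) rss \<in> listset (map (args A) jss)"
    using rss by (auto simp: in_listset_map_iff mem_Times_iff)
  \<comment> \<open>Associativity of \<open>A\<close> is used once per coordinate. Projecting
    \<open>concat rss\<close> gives the concatenation of the projected blocks, hence the witnesses
    \<open>map (map fst) rss\<close> and \<open>map (map snd) rss\<close>; the lengths keep every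
    position of the tuple valid.\<close>
  with p args_squareD[OF qs] show
    "opmu (square_operad A) (concat jss) (opmu (square_operad A) (map length jss) p qs) (concat rss) =
     opmu (square_operad A) (map sum_list jss) p
       (tuple (length jss) (\<lambda>i. opmu (square_operad A) (jss !\<^sub>1 i) (qs !\<^sub>1 i) (rss !\<^sub>1 i)))"
    using operad_assoc[OF A, of "fst p" jss "map fst qs" "map (map fst) rss"]
      operad_assoc[OF A, of "snd p" jss "map snd qs" "map (map snd) rss"] len
    by (auto simp: map_tuple map_concat intro!: arg_cong[where f = "opmu A _ _"] tuple_cong)
qed

section \<open>Equivariance of the square\<close>

lemma action_operad_perm_permutes:
  assumes "action_operad L" "g \<in> ops L n"
  shows "perm L n g permutes {1..n}"
  using assms unfolding action_operad_def operad_map_def Sigma_operad_def sym_group_def by auto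

lemma right_action_square:
  "right_action G X act \<Longrightarrow>
   right_action G (X \<times> X) (\<lambda>f g. (act (fst f) g, act (snd f) g))"
  unfolding right_action_def by auto

text \<open>The same group elements act on both coordinates, so each axiom is two instances of the
  axiom for \<open>A\<close>. That \<open>L\<close> is an action operad makes
  \<open>perm_inv\<close> a permutation, whence the projections commute with
  \<open>reindex\<close>.\<close>

lemma equivariant_operad_square:
  assumes L: "action_operad L" and A: "equivariant_operad L A act"
  shows "equivariant_operad L (square_operad A) (\<lambda>n f g. (act n (fst f) g, act n (snd f) g))"
  unfolding equivariant_operad_def
proof (intro conjI allI ballI)
  show "operad (square_operad A)"
    using A operad_square unfolding equivariant_operad_def by blast
next
  fix n
  have "right_action (grp L n) (ops A n) (act n)"
    using A unfolding equivariant_operad_def by blast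
  then show "right_action (grp L n) (ops (square_operad A) n)
      (\<lambda>f g. (act n (fst f) g, act n (snd f) g))"
    using right_action_square by simp
next
  fix ks p qs gs
  assume p: "p \<in> ops (square_operad A) (length ks)"
    and qs: "qs \<in> args (square_operad A) ks" and gs: "gs \<in> args L ks"
  have *: "opmu A ks p (tuple (length ks) (\<lambda>i. act (ks !\<^sub>1 i) (qs !\<^sub>1 i) (gs !\<^sub>1 i))) =
        act (sum_list ks) (opmu A ks p qs) (Lambda_beta L ks gs)"
    if "p \<in> ops A (length ks)" "qs \<in> args A ks" for p qs
    using A gs that unfolding equivariant_operad_def by blast
  have "tuple (length ks) (\<lambda>i. act (ks !\<^sub>1 i) (map h qs !\<^sub>1 i) (gs !\<^sub>1 i)) =
    tuple (length ks) (\<lambda>i. act (ks !\<^sub>1 i) (h (qs !\<^sub>1 i)) (gs !\<^sub>1 i))" for h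
    using args_squareD(3)[OF qs] by (auto intro!: tuple_cong)
  then show "opmu (square_operad A) ks p
      (tuple (length ks) (\<lambda>i. (act (ks !\<^sub>1 i) (fst (qs !\<^sub>1 i)) (gs !\<^sub>1 i),
                               act (ks !\<^sub>1 i) (snd (qs !\<^sub>1 i)) (gs !\<^sub>1 i)))) =
    (act (sum_list ks) (fst (opmu (square_operad A) ks p qs)) (Lambda_beta L ks gs),
     act (sum_list ks) (snd (opmu (square_operad A) ks p qs)) (Lambda_beta L ks gs))"
    using p *[of "fst p" "map fst qs"] *[of "snd p" "map snd qs"] args_squareD[OF qs]
    by (auto simp: map_tuple)
next
  fix ks p qs g
  assume p: "p \<in> ops (square_operad A) (length ks)"
    and qs: "qs \<in> args (square_operad A) ks" and g: "g \<in> ops L (length ks)"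
  let ?s = "perm_inv L (length ks) g"
  have "?s permutes {1..length qs}"
    using permutes_inv[OF action_operad_perm_permutes[OF L g]] args_squareD(3)[OF qs] by simp
  note map_s = map_reindex[OF this]
  have "opmu A ks (act (length ks) p g) qs =
        act (sum_list ks) (opmu A (reindex ?s ks) p (reindex ?s qs)) (Lambda_delta L ks g)"
    if "p \<in> ops A (length ks)" "qs \<in> args A ks" for p qs
    using A g that unfolding equivariant_operad_def by blast
  from this[of "fst p" "map fst qs"] this[of "snd p" "map snd qs"]
  show "opmu (square_operad A) ks (act (length ks) (fst p) g, act (length ks) (snd p) g) qs =
    (act (sum_list ks) (fst (opmu (square_operad A) (reindex ?s ks) p (reindex ?s qs)))
       (Lambda_delta L ks g),
     act (sum_list ks) (snd (opmu (square_operad A) (reindex ?s ks) p (reindex ?s qs)))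
       (Lambda_delta L ks g))"
    using p args_squareD[OF qs] by (auto simp: map_s)
qed


section \<open>Action operads act on themselves\<close>

text \<open>\<open>equivariant_operad\<close> expects a bare operad record, so \<open>grp\<close>
  and \<open>perm\<close> are dropped from \<open>L\<close>; the operad axioms read only the fields
  that remain.\<close>

lemma operad_truncate: "operad (operad.truncate A) \<longleftrightarrow> operad A"
  by (simp add: operad_def operad.defs)

lemma action_operad_equivariant:
  assumes L: "action_operad L"
  shows "equivariant_operad L (operad.truncate L) (\<lambda>n x g. x \<otimes>\<^bsub>grp L n\<^esub> g)"
proof -
  have op: "operad L"
    and grp: "group (grp L n)" and car: "carrier (grp L n) = ops L n" for n
    using L by (auto simp: action_operad_def)
  interpret G: group "grp L n" for n by (rule grp)
  have one: "\<one>\<^bsub>grp L n\<^esub> \<in> ops L n" for n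
    using G.one_closed[of n] by (simp only: car)
  have inter: "opmu L (reindex (perm_inv L (length ks) g) ks) g' fs'
            \<otimes>\<^bsub>grp L (sum_list ks)\<^esub> opmu L ks g fs =
          opmu L ks (g' \<otimes>\<^bsub>grp L (length ks)\<^esub> g)
            (tuple (length ks) (\<lambda>i.
               (fs' !\<^sub>1 perm L (length ks) g i) \<otimes>\<^bsub>grp L (ks !\<^sub>1 i)\<^esub> (fs !\<^sub>1 i)))"
    if "g \<in> ops L (length ks)" "g' \<in> ops L (length ks)" "fs \<in> args L ks"
      "fs' \<in> args L (reindex (perm_inv L (length ks) g) ks)" for ks g g' fs fs'
    using L that unfolding action_operad_def by blast
  \<comment> \<open>For g = e the reindexing in the interchange law becomes trivial, because a
    homomorphism preserves units.\<close>
  have perm_one: "perm L n \<one>\<^bsub>grp L n\<^esub> = id" for n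
  proof -
    have "perm L n \<in> hom (grp L n) (sym_group n)"
      using L by (simp add: action_operad_def)
    from hom_one[OF this grp sym_group_is_group] show ?thesis
      by (simp add: sym_group_def)
  qed
  show ?thesis
    unfolding equivariant_operad_def
  proof (intro conjI allI ballI)
    show "operad (operad.truncate L)"
      using op by (simp add: operad_truncate)
  next
    fix n
    show "right_action (grp L n) (ops (operad.truncate L) n) (\<lambda>x g. x \<otimes>\<^bsub>grp L n\<^esub> g)"
      by (auto simp: right_action_def operad.defs G.m_assoc simp flip: car)
  next
    fix ks p qs gs
    assume "p \<in> ops (operad.truncate L) (length ks)" "qs \<in> args (operad.truncate L) ks"
      and "gs \<in> args L ks"
    then show "opmu (operad.truncate L) ks p
        (tuple (length ks) (\<lambda>i. (qs !\<^sub>1 i) \<otimes>\<^bsub>grp L (ks !\<^sub>1 i)\<^esub> (gs !\<^sub>1 i))) =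
      opmu (operad.truncate L) ks p qs \<otimes>\<^bsub>grp L (sum_list ks)\<^esub> Lambda_beta L ks gs"
      \<comment> \<open>Here g = e, g' = \<open>p\<close>, the unprimed arguments are
        \<open>gs\<close> and the primed ones \<open>qs\<close>; the first entry on the right is
        \<open>p\<close> times e, that is \<open>p\<close>.\<close>
      using inter[of "\<one>\<^bsub>grp L (length ks)\<^esub>" ks p gs qs]
      by (simp add: operad.defs perm_one one Lambda_beta_def flip: car)
  next
    fix ks p qs g
    assume "p \<in> ops (operad.truncate L) (length ks)" "qs \<in> args (operad.truncate L) ks"
      and g: "g \<in> ops L (length ks)"
    then have p: "p \<in> ops L (length ks)" and qs: "qs \<in> args L ks"
      by (simp_all add: operad.defs)
    let ?g = "perm L (length ks) g"
    let ?es = "map (\<lambda>k. \<one>\<^bsub>grp L k\<^esub>) ks"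
    have perm: "?g permutes {1..length ks}"
      by (rule action_operad_perm_permutes[OF L g])
    have es: "?es \<in> args L ks"
      by (simp add: in_listset_map_iff one)
    have qs': "reindex (inv' ?g) qs \<in> args L (reindex (inv' ?g) ks)"
      by (rule reindex_in_listset[OF qs permutes_inv[OF perm]])
    have len: "length qs = length ks"
      using qs by (simp add: in_listset_map_iff)
    \<comment> \<open>The primed arguments are \<open>qs\<close> permuted by the inverse of
      \<open>?g\<close>, so reading them at position \<open>?g (Suc i)\<close> undoes the
      permutation. Multiplying by units then leaves \<open>qs\<close> as the whole argument tuple of
      the interchange law.\<close>
    have "(reindex (inv' ?g) qs !\<^sub>1 ?g (Suc i)) \<otimes>\<^bsub>grp L (ks ! i)\<^esub> (?es ! i) = qs ! i"
      if i: "i < length ks" for i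
    proof -
      have "?g (Suc i) \<in> {1..length ks}"
        using permutes_in_image[OF perm, of "Suc i"] i by auto
      then have "reindex (inv' ?g) qs !\<^sub>1 ?g (Suc i) = qs ! i"
        using len permutes_inverses(2)[OF perm, of "Suc i"] by (auto simp: reindex_def)
      moreover have "qs ! i \<in> carrier (grp L (ks ! i))"
        using qs i by (simp add: in_listset_map_iff car)
      ultimately show ?thesis using i by simp
    qed
    then have "tuple (length ks) (\<lambda>i. (reindex (inv' ?g) qs !\<^sub>1 ?g i) \<otimes>\<^bsub>grp L (ks !\<^sub>1 i)\<^esub> (?es !\<^sub>1 i))
      = qs"
      using len by (intro nth_equalityI) simp_all
    with inter[OF g p es qs']
    show "opmu (operad.truncate L) ks (p \<otimes>\<^bsub>grp L (length ks)\<^esub> g) qs =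
      opmu (operad.truncate L) (reindex (inv' ?g) ks) p (reindex (inv' ?g) qs)
        \<otimes>\<^bsub>grp L (sum_list ks)\<^esub> Lambda_delta L ks g"
      by (simp add: operad.defs Lambda_delta_def)
  qed
qed


section \<open>Products of categories and functors into \<open>EX\<close>\<close>

lemma category_prod_cat:
  assumes "\<And>C. C \<in> set Cs \<Longrightarrow> category C"
  shows "category (prod_cat Cs)"
proof -
  have C: "category (Cs ! i)" if "i < length Cs" for i
    using assms that by simp
  show ?thesis
    unfolding category_def
    by (auto simp: prod_cat_def in_listset_map_iff list_eq_iff_nth_eq
        C[unfolded category_def, rule_format])
qed

lemma category_E_cat: "category (E_cat X)"
  by (auto simp: category_def E_cat_def)

text \<open>Parallel morphisms of \<open>E_cat X\<close> are equal, so identities and composites are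
  preserved as soon as sources and targets are. This covers both the composition functors and the
  action functors.\<close>

lemma is_functor_E_cat:
  assumes "category C" "\<And>x. x \<in> Obj C \<Longrightarrow> F\<^sub>o x \<in> X"
    and "\<And>f. f \<in> Arr C \<Longrightarrow> F\<^sub>m f = (F\<^sub>o (Dom C f), F\<^sub>o (Cod C f))"
  shows "is_functor C (E_cat X) F\<^sub>o F\<^sub>m"
  using assms category_E_cat[of X] unfolding is_functor_def
  by (auto simp: category_def E_cat_def)

section \<open>Assembling the \<Lambda>-operad\<close>

lemma obj_operad_E_operad: "obj_operad (E_operad L) = operad.truncate L"
  by (simp add: obj_operad_def E_operad_def E_cat_def operad.defs)

text \<open>The units agree because the identity morphism of \<open>opid L\<close> is the pair
  \<open>(opid L, opid L)\<close>.\<close>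

lemma arr_operad_E_operad: "arr_operad (E_operad L) = square_operad (operad.truncate L)"
  by (simp add: arr_operad_def E_operad_def E_cat_def operad.defs square_operad_def)

theorem corollary12p14:
  fixes L :: "'g action_operad"
  assumes "action_operad L"
  shows "Lambda_operad L (E_operad L)"
  unfolding Lambda_operad_def
proof (intro conjI allI ballI)
  have op: "operad L" using assms by (simp add: action_operad_def)
  have obj: "equivariant_operad L (operad.truncate L) (act_obj (E_operad L))"
    using action_operad_equivariant[OF assms] by (simp add: E_operad_def)
  then show "equivariant_operad L (obj_operad (E_operad L)) (act_obj (E_operad L))"
    by (simp add: obj_operad_E_operad)
  \<comment> \<open>This exhibits the action on morphisms as the coordinatewise one that
    \<open>equivariant_operad_square\<close> handles.\<close>
  have "act_arr (E_operad L) =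
      (\<lambda>n f g. (act_obj (E_operad L) n (fst f) g, act_obj (E_operad L) n (snd f) g))"
    by (simp add: E_operad_def)
  then show "equivariant_operad L (arr_operad (E_operad L)) (act_arr (E_operad L))"
    using equivariant_operad_square[OF assms obj] by (simp add: arr_operad_E_operad)
  show cat: "category (cats (E_operad L) n)" for n
    by (simp add: E_operad_def category_E_cat)
  show "is_functor (cats (E_operad L) n) (cats (E_operad L) n)
      (\<lambda>x. act_obj (E_operad L) n x g) (\<lambda>f. act_arr (E_operad L) n f g)"
    if "g \<in> ops L n" for n g
  proof -
    have "x \<otimes>\<^bsub>grp L n\<^esub> g \<in> ops L n" if "x \<in> ops L n" for x
      using assms that \<open>g \<in> ops L n\<close> monoid.m_closed[OF group.is_monoid, of "grp L n" x g]
      by (simp add: action_operad_def)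
    then show ?thesis
      unfolding E_operad_def cat_operad.simps
      by (intro is_functor_E_cat category_E_cat) (simp_all add: E_cat_def)
  qed
  fix ks
  let ?C = "prod_cat (cats (E_operad L) (length ks) # map (cats (E_operad L)) ks)"
  have "is_functor ?C (E_cat (ops L (sum_list ks)))
    (\<lambda>xs. mu_obj (E_operad L) ks (hd xs) (tl xs)) (\<lambda>fs. mu_arr (E_operad L) ks (hd fs) (tl fs))"
  proof (rule is_functor_E_cat)
    show "category ?C"
      by (rule category_prod_cat) (use cat in auto)
  next
    fix xs assume "xs \<in> Obj ?C"
    then show "mu_obj (E_operad L) ks (hd xs) (tl xs) \<in> ops L (sum_list ks)"
      using operad_closed[OF op]
      by (auto simp: prod_cat_def E_operad_def E_cat_def set_Cons_def comp_def)
  next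
    fix fs assume "fs \<in> Arr ?C"
    then obtain h ts where fs: "fs = h # ts" "length ts = length ks"
      by (auto simp: prod_cat_def set_Cons_def in_listset_iff)
    \<comment> \<open>Sources and targets in the product are taken entrywise; \<open>map2\<close>
      stops at the shorter list, so the equality of lengths is essential.\<close>
    have "map2 Dom (map (cats (E_operad L)) ks) ts = map fst ts"
         "map2 Cod (map (cats (E_operad L)) ks) ts = map snd ts"
      using fs(2) by (auto simp: list_eq_iff_nth_eq E_operad_def E_cat_def)
    then show "mu_arr (E_operad L) ks (hd fs) (tl fs) =
      (mu_obj (E_operad L) ks (hd (Dom ?C fs)) (tl (Dom ?C fs)),
       mu_obj (E_operad L) ks (hd (Cod ?C fs)) (tl (Cod ?C fs)))"
      by (simp add: fs(1) prod_cat_def) (simp add: E_operad_def E_cat_def)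
  qed
  then show "is_functor ?C (cats (E_operad L) (sum_list ks))
    (\<lambda>xs. mu_obj (E_operad L) ks (hd xs) (tl xs)) (\<lambda>fs. mu_arr (E_operad L) ks (hd fs) (tl fs))"
    by (simp add: E_operad_def)
qed

end
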